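(* Every 2-CNF theory (respectively, every normal 2-program, every disjunctive 2-program) with $n$ atoms has at most $3^{n/3} = 1.4422\ldots^n$ minimal models (respectively, stable models, answer sets).
   Context: A $t$-CNF theory is a finite set of propositional clauses, each containing at most $t$ literals; clauses contain no repeated literal and no pair of complementary literals. A normal program clause has the form $a \leftarrow b_1,\ldots,b_r,\mathbf{not}(c_1),\ldots,\mathbf{not}(c_s)$ and a disjunctive program clause the form $a_1\vee\cdots\vee a_p \leftarrow b_1,\ldots,b_r,\mathbf{not}(c_1),\ldots,\mathbf{not}(c_s)$; a (normal or disjunctive) $t$-program is a finite set of such clauses, each containing at most $t$ literals. Models, stable models (Gelfond–Lifschitz) and answer sets (minimal models of the Gelfond–Lifschitz reduct $P^M$) are represented as sets of true atoms; a model is minimal if no proper subset is a model. $n$ is the number of atoms occurring in the theory or program. *)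

theory Defs
  imports Complex_Main
begin

datatype 'a literal = Pos 'a | Neg 'a

fun atom_of :: "'a literal \<Rightarrow> 'a" where
  "atom_of (Pos a) = a"
| "atom_of (Neg a) = a"

fun sat_literal :: "'a set \<Rightarrow> 'a literal \<Rightarrow> bool" where
  "sat_literal M (Pos a) \<longleftrightarrow> a \<in> M"
| "sat_literal M (Neg a) \<longleftrightarrow> a \<notin> M"

text \<open>A propositional clause is the set of its literals, so no literal is repeated.\<close>

definition cnf_theory :: "nat \<Rightarrow> 'a literal set set \<Rightarrow> bool" where
  "cnf_theory t T \<longleftrightarrow> finite T \<and>
     (\<forall>C\<in>T. finite C \<and> card C \<le> t \<and> \<not> (\<exists>a. Pos a \<in> C \<and> Neg a \<in> C))"

definition cnf_atoms :: "'a literal set set \<Rightarrow> 'a set" where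
  "cnf_atoms T = (\<Union>C\<in>T. atom_of ` C)"

definition cnf_model :: "'a literal set set \<Rightarrow> 'a set \<Rightarrow> bool" where
  "cnf_model T M \<longleftrightarrow> (\<forall>C\<in>T. \<exists>l\<in>C. sat_literal M l)"

definition minimal_model :: "('a set \<Rightarrow> bool) \<Rightarrow> 'a set \<Rightarrow> bool" where
  "minimal_model model M \<longleftrightarrow> model M \<and> \<not> (\<exists>N. N \<subset> M \<and> model N)"

definition least_model :: "('a set \<Rightarrow> bool) \<Rightarrow> 'a set \<Rightarrow> bool" where
  "least_model model M \<longleftrightarrow> model M \<and> (\<forall>N. model N \<longrightarrow> M \<subseteq> N)"

text \<open>
  \<open>Rule {a\<^sub>1,\<dots>,a\<^sub>p} {b\<^sub>1,\<dots>,b\<^sub>r} {c\<^sub>1,\<dots>,c\<^sub>s}\<close> stands for the program clause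
  \<open>a\<^sub>1 \<or> \<dots> \<or> a\<^sub>p \<leftarrow> b\<^sub>1, \<dots>, b\<^sub>r, not(c\<^sub>1), \<dots>, not(c\<^sub>s)\<close>. Each of \<open>p\<close>, \<open>r\<close>, \<open>s\<close> may be \<open>0\<close>;
  normal clauses are those with exactly one head atom. Literal occurrences in the head, the
  positive body and the negative body are counted separately, and no clause is excluded for
  mentioning the same atom in several of these parts.
\<close>

datatype 'a pclause = Rule (head: "'a set") (pbody: "'a set") (nbody: "'a set")

definition disjunctive_program :: "nat \<Rightarrow> 'a pclause set \<Rightarrow> bool" where
  "disjunctive_program t P \<longleftrightarrow> finite P \<and>
     (\<forall>C\<in>P. finite (head C) \<and> finite (pbody C) \<and> finite (nbody C) \<and>
            card (head C) + card (pbody C) + card (nbody C) \<le> t)"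

definition normal_program :: "nat \<Rightarrow> 'a pclause set \<Rightarrow> bool" where
  "normal_program t P \<longleftrightarrow> disjunctive_program t P \<and> (\<forall>C\<in>P. \<exists>a. head C = {a})"

definition program_atoms :: "'a pclause set \<Rightarrow> 'a set" where
  "program_atoms P = (\<Union>C\<in>P. head C \<union> pbody C \<union> nbody C)"

definition program_model :: "'a pclause set \<Rightarrow> 'a set \<Rightarrow> bool" where
  "program_model P M \<longleftrightarrow>
     (\<forall>C\<in>P. pbody C \<subseteq> M \<and> nbody C \<inter> M = {} \<longrightarrow> head C \<inter> M \<noteq> {})"

definition gl_reduct :: "'a pclause set \<Rightarrow> 'a set \<Rightarrow> 'a pclause set" where
  "gl_reduct P M = {Rule (head C) (pbody C) {} | C. C \<in> P \<and> nbody C \<inter> M = {}}"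

definition stable_model :: "'a pclause set \<Rightarrow> 'a set \<Rightarrow> bool" where
  "stable_model P M \<longleftrightarrow> least_model (program_model (gl_reduct P M)) M"

definition answer_set :: "'a pclause set \<Rightarrow> 'a set \<Rightarrow> bool" where
  "answer_set P M \<longleftrightarrow> minimal_model (program_model (gl_reduct P M)) M"

end

theory Submission
  imports Defs
begin

text \<open>
  Call two atoms of a 2-CNF theory adjacent if every model contains at least one of them; a loop
  marks an atom that lies in every model. If \<open>M\<close> is a minimal model and \<open>a \<in> M\<close>, delete from \<open>M\<close>
  all atoms that imply \<open>a\<close>. The result violates a clause, and since clauses have at most two
  literals this forces \<open>a\<close> to be looped or adjacent to an atom outside \<open>M\<close>. Hence the complement
  of \<open>M\<close> is a maximal independent set among the loop-free atoms, and the Moon--Moser bound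
  \<open>3\<^bsup>n/3\<^esup>\<close> applies. Answer sets, and so also stable models, are minimal models of the program
  read as a 2-CNF theory.
\<close>

section \<open>Counting maximal independent sets\<close>

text \<open>Maximality is encoded as domination of \<open>V - I\<close>, a form that restricts well
  to the complement of a closed neighbourhood.\<close>

definition maximal_independent :: "('a \<Rightarrow> 'a \<Rightarrow> bool) \<Rightarrow> 'a set \<Rightarrow> 'a set \<Rightarrow> bool" where
  "maximal_independent E V I \<longleftrightarrow>
     I \<subseteq> V \<and> (\<forall>u\<in>I. \<forall>v\<in>I. \<not> E u v) \<and> (\<forall>v\<in>V - I. \<exists>u\<in>I. E v u)"

text \<open>Integer form of \<open>k \<le> 3 powr (k / 3)\<close>, tight at \<open>k = 3\<close>.
  From \<open>m \<ge> 3\<close> on, passing to \<open>m + 1\<close> multiplies the cube by at most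
  3.\<close>

lemma cube_le_three_power: "k ^ 3 \<le> (3::nat) ^ k"
proof (induction k rule: less_induct)
  case (less k)
  show ?case
  proof (cases "k \<le> 3")
    case True
    then have "k = 0 \<or> k = 1 \<or> k = 2 \<or> k = 3" by linarith
    then show ?thesis by auto
  next
    case False
    then obtain m where k: "k = Suc m" and m: "3 \<le> m" by (cases k) auto
    have "3 * (m * m) \<le> m ^ 3"
      using mult_le_mono1[OF m, of "m * m"] by (simp add: power3_eq_cube)
    moreover have "3 * m \<le> m * m" using m by simp
    ultimately have "m ^ 3 + 3 * (m * m) + 3 * m + 1 \<le> 3 * m ^ 3"
      using m by linarith
    then have "k ^ 3 \<le> 3 * m ^ 3"
      by (simp add: k power3_eq_cube algebra_simps)
    also have "\<dots> \<le> 3 ^ k" using less[of m] k by simp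
    finally show ?thesis .
  qed
qed

lemma three_powr_third_power: "(3::real) powr (real n / 3) = (3 powr (1 / 3)) ^ n"
  by (simp add: powr_power)

lemma three_powr_third_cube: "((3::real) powr (1 / 3)) ^ 3 = 3"
  using three_powr_third_power[of 3] by simp

lemma le_three_powr_third: "real k \<le> 3 powr (real k / 3)"
\<comment> \<open>The rule compares powers with exponent of the form \<open>Suc n\<close>, so the
  cubes are written with \<open>Suc 2\<close>.\<close>
proof (rule power_le_imp_le_base)
  have "real k ^ 3 \<le> 3 ^ k"
    using cube_le_three_power[of k] by (metis of_nat_le_iff of_nat_power of_nat_numeral)
  also have "\<dots> = (3 powr (real k / 3)) ^ Suc 2"
    by (simp add: powr_power powr_realpow del: power_Suc)
  finally show "real k ^ Suc 2 \<le> (3 powr (real k / 3)) ^ Suc 2"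
    by (simp add: eval_nat_numeral)
qed simp

text \<open>
  Branch on the closed neighbourhood of a vertex of least degree: with \<open>k\<close> its size, this gives
  \<open>k\<close> branches that each lose at least \<open>k\<close> vertices, and \<open>k \<le> 3\<^bsup>k/3\<^esup>\<close>.
\<close>

theorem card_maximal_independent_le:
  assumes "finite V" and sym: "\<And>u v. E u v \<Longrightarrow> E v u"
  shows "real (card {I. maximal_independent E V I}) \<le> 3 powr (real (card V) / 3)"
  using \<open>finite V\<close>
proof (induction V rule: finite_psubset_induct)
  case (psubset V)
  show ?case
  proof (cases "V = {}")
    case True
    then have "{I. maximal_independent E V I} = {{}}"
      by (auto simp: maximal_independent_def)
    then show ?thesis by (simp add: True)
  next
    case False
    define N where "N u = {w \<in> V. w = u \<or> E u w}" for u
    obtain v where v: "v \<in> V" and vmin: "\<And>u. u \<in> V \<Longrightarrow> card (N v) \<le> card (N u)"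
      using False ex_has_least_nat[of "\<lambda>u. u \<in> V" _ "\<lambda>u. card (N u)"] by blast
    have finN: "finite (N u)" for u using psubset.hyps by (simp add: N_def)
    have NV: "N u \<subseteq> V" for u by (auto simp: N_def)
    let ?F = "\<lambda>u. {J. maximal_independent E (V - N u) J}"
    have finF: "finite (?F u)" for u
      by (rule finite_subset[of _ "Pow V"])
         (use psubset.hyps in \<open>auto simp: maximal_independent_def\<close>)
    have step: "I \<in> (\<Union>u\<in>N v. insert u ` ?F u)" if I: "maximal_independent E V I" for I
    proof -
      \<comment> \<open>Either \<open>v\<close> itself is in \<open>I\<close>, or domination
        supplies a neighbour of \<open>v\<close> in \<open>I\<close>.\<close>
      obtain u where u: "u \<in> I" "u \<in> N v"
        using I v unfolding maximal_independent_def N_def by blast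
      \<comment> \<open>Independence keeps the rest of \<open>I\<close> out of \<open>N u\<close>. A
        vertex outside \<open>N u\<close> is not adjacent to \<open>u\<close>, so whatever dominates
        it in \<open>I\<close> survives the removal of \<open>u\<close>.\<close>
      have "maximal_independent E (V - N u) (I - {u})"
        using I u sym unfolding maximal_independent_def N_def by blast
      moreover have "I = insert u (I - {u})" using u by blast
      ultimately show ?thesis using u by blast
    qed
    have branch: "real (card (?F u)) \<le> 3 powr ((real (card V) - real (card (N v))) / 3)"
      if u: "u \<in> N v" for u
    proof -
      have uV: "u \<in> V" using u NV by blast
      then have "V - N u \<subset> V" by (auto simp: N_def)
      then have "real (card (?F u)) \<le> 3 powr (real (card (V - N u)) / 3)"
        by (rule psubset.IH)
      \<comment> \<open>By the choice of \<open>v\<close>, deleting \<open>N u\<close> removes at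
        least \<open>card (N v)\<close> vertices.\<close>
      also have "\<dots> \<le> 3 powr ((real (card V) - real (card (N v))) / 3)"
        using vmin[OF uV] card_mono[OF psubset.hyps(1) NV[of u]]
        by (intro powr_mono) (auto simp: card_Diff_subset[OF finN NV])
      finally show ?thesis .
    qed
    have "card {I. maximal_independent E V I} \<le> card (\<Union>u\<in>N v. insert u ` ?F u)"
      by (rule card_mono) (use finN finF step in auto)
    also have "\<dots> \<le> (\<Sum>u\<in>N v. card (insert u ` ?F u))"
      by (rule card_UN_le[OF finN])
    also have "\<dots> \<le> (\<Sum>u\<in>N v. card (?F u))"
      by (intro sum_mono card_image_le finF)
    finally have "real (card {I. maximal_independent E V I}) \<le> (\<Sum>u\<in>N v. real (card (?F u)))"
      by (metis of_nat_le_iff of_nat_sum)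
    also have "\<dots> \<le> real (card (N v)) * 3 powr ((real (card V) - real (card (N v))) / 3)"
      using sum_bounded_above[of "N v" "\<lambda>u. real (card (?F u))"] branch by blast
    also have "\<dots> \<le> 3 powr (real (card (N v)) / 3)
        * 3 powr ((real (card V) - real (card (N v))) / 3)"
      by (intro mult_right_mono le_three_powr_third) simp
    also have "\<dots> = 3 powr (real (card V) / 3)"
      by (simp add: diff_divide_distrib flip: powr_add)
    finally show ?thesis .
  qed
qed

section \<open>Minimal models of 2-CNF theories\<close>

text \<open>Atoms foreign to \<open>T\<close> affect no clause, so intersecting a model with
  \<open>cnf_atoms T\<close> leaves a model.\<close>

lemma minimal_model_subset_atoms:
  assumes "minimal_model (cnf_model T) M"
  shows "M \<subseteq> cnf_atoms T"
proof -
  have "sat_literal (M \<inter> cnf_atoms T) l \<longleftrightarrow> sat_literal M l" if "C \<in> T" "l \<in> C" for C l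
  proof -
    have "atom_of l \<in> cnf_atoms T" using that by (auto simp: cnf_atoms_def)
    then show ?thesis by (cases l) auto
  qed
  moreover have "cnf_model T M" using assms by (simp add: minimal_model_def)
  ultimately have "cnf_model T (M \<inter> cnf_atoms T)"
    unfolding cnf_model_def by metis
  then show ?thesis
    using assms unfolding minimal_model_def by blast
qed

lemma minimal_model_support:
  assumes T: "cnf_theory 2 T" and M: "minimal_model (cnf_model T) M" and a: "a \<in> M"
  shows "(\<forall>N. cnf_model T N \<longrightarrow> a \<in> N) \<or>
         (\<exists>y \<in> cnf_atoms T - M. \<forall>N. cnf_model T N \<longrightarrow> a \<in> N \<or> y \<in> N)"
proof -
  define D where "D = {b \<in> M. \<forall>N. cnf_model T N \<longrightarrow> b \<in> N \<longrightarrow> a \<in> N}"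
  have "M - D \<subset> M" using a by (auto simp: D_def)
  then have "\<not> cnf_model T (M - D)" using M by (auto simp: minimal_model_def)
  then obtain C where C: "C \<in> T" and viol: "\<And>l. l \<in> C \<Longrightarrow> \<not> sat_literal (M - D) l"
    by (auto simp: cnf_model_def)
  have "cnf_model T M" using M by (simp add: minimal_model_def)
  then obtain l where l: "l \<in> C" "sat_literal M l"
    using C unfolding cnf_model_def by blast
  \<comment> \<open>Shrinking \<open>M\<close> can falsify only positive literals, so the literal
    lost has its atom in \<open>D\<close>.\<close>
  then obtain x where x: "l = Pos x" "x \<in> D"
    using viol[OF l(1)] by (cases l) auto
  have clause: "\<exists>l\<in>C. sat_literal N l" if "cnf_model T N" for N
    using that C by (auto simp: cnf_model_def)
  have imp: "a \<in> N" if "b \<in> D" "cnf_model T N" "b \<in> N" for b N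
    using that by (auto simp: D_def)
  have fin: "finite C" "card C \<le> 2" using T C by (auto simp: cnf_theory_def)
  then have "card (C - {Pos x}) \<le> 1" using l x by simp
  then have "\<forall>l1\<in>C - {Pos x}. \<forall>l2\<in>C - {Pos x}. l1 = l2"
    using fin card_le_Suc0_iff_eq[of "C - {Pos x}"] by simp
  moreover have "Pos x \<in> C" using l x by simp
  ultimately consider "C = {Pos x}" | l' where "C = {Pos x, l'}"
    by (cases "C - {Pos x} = {}") blast+
  then show ?thesis
  proof cases
    case 1
    then have "a \<in> N" if "cnf_model T N" for N
      using clause[OF that] imp[OF x(2) that] by simp
    then show ?thesis by blast
  next
    case (2 l')
    show ?thesis
    proof (cases l')
      case (Neg y)
      \<comment> \<open>Here \<open>C\<close> says that \<open>y\<close> implies \<open>x\<close>,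
        and \<open>x\<close> implies \<open>a\<close>; so \<open>y\<close> would belong to
        \<open>D\<close>, a contradiction.\<close>
      have "y \<in> M - D" using viol[of l'] 2 Neg by auto
      moreover have "a \<in> N" if "cnf_model T N" "y \<in> N" for N
        using clause[OF that(1)] imp[OF x(2) that(1)] 2 Neg that by auto
      ultimately show ?thesis unfolding D_def by blast
    next
      case (Pos y)
      have cover: "a \<in> N \<or> y \<in> N" if "cnf_model T N" for N
        using clause[OF that] imp[OF x(2) that] 2 Pos by auto
      have "y \<in> cnf_atoms T" using C 2 Pos by (force simp: cnf_atoms_def)
      \<comment> \<open>If \<open>y\<close> is outside \<open>M\<close>, it is the required
        neighbour of \<open>a\<close>. If it is in \<open>D\<close>, both literals of
        \<open>C\<close> imply \<open>a\<close>, which then lies in every model.\<close>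
      moreover have "y \<notin> M \<or> y \<in> D" using viol[of l'] 2 Pos by auto
      ultimately show ?thesis using cover imp[of y] by blast
    qed
  qed
qed

lemma finite_cnf_atoms: "cnf_theory t T \<Longrightarrow> finite (cnf_atoms T)"
  by (auto simp: cnf_theory_def cnf_atoms_def)

lemma finite_minimal_models:
  assumes "cnf_theory t T"
  shows "finite {M. minimal_model (cnf_model T) M}"
proof (rule finite_subset)
  show "{M. minimal_model (cnf_model T) M} \<subseteq> Pow (cnf_atoms T)"
    by (auto dest: minimal_model_subset_atoms)
  show "finite (Pow (cnf_atoms T))"
    using finite_cnf_atoms[OF assms] by simp
qed

theorem card_minimal_models_le:
  assumes T: "cnf_theory 2 T"
  shows "real (card {M. minimal_model (cnf_model T) M}) \<le> 3 powr (real (card (cnf_atoms T)) / 3)"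
proof -
  define E where "E a b \<longleftrightarrow> (\<forall>N. cnf_model T N \<longrightarrow> a \<in> N \<or> b \<in> N)" for a b
  define V where "V = {a \<in> cnf_atoms T. \<not> E a a}"
  let ?Min = "{M. minimal_model (cnf_model T) M}"
  have finV: "finite V" "card V \<le> card (cnf_atoms T)"
    using finite_cnf_atoms[OF T] by (auto simp: V_def intro: card_mono)
  have "maximal_independent E V (cnf_atoms T - M)" if M: "minimal_model (cnf_model T) M" for M
  proof -
    have mod: "cnf_model T M" using M by (simp add: minimal_model_def)
    have "E v v \<or> (\<exists>u\<in>cnf_atoms T - M. E v u)" if "v \<in> M" for v
      using minimal_model_support[OF T M that] unfolding E_def by blast
    \<comment> \<open>The model \<open>M\<close> omits both atoms. With \<open>u = v\<close> this
      also shows that atoms outside \<open>M\<close> are loop-free.\<close>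
    moreover have "\<not> E u v" if "u \<notin> M" "v \<notin> M" for u v
      using mod that by (auto simp: E_def)
    ultimately show ?thesis
      unfolding maximal_independent_def V_def by blast
  qed
  moreover have "inj_on (\<lambda>M. cnf_atoms T - M) ?Min"
  proof (rule inj_onI)
    fix M M' assume "M \<in> ?Min" "M' \<in> ?Min" and eq: "cnf_atoms T - M = cnf_atoms T - M'"
    then have "M \<subseteq> cnf_atoms T" "M' \<subseteq> cnf_atoms T"
      by (auto dest: minimal_model_subset_atoms)
    with eq show "M = M'" by blast
  qed
  moreover have "finite {I. maximal_independent E V I}"
    by (rule finite_subset[of _ "Pow V"]) (use finV in \<open>auto simp: maximal_independent_def\<close>)
  ultimately have "card ?Min \<le> card {I. maximal_independent E V I}"
    by (intro card_inj_on_le) auto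
  then have "real (card ?Min) \<le> real (card {I. maximal_independent E V I})" by simp
  also have "\<dots> \<le> 3 powr (real (card V) / 3)"
    by (rule card_maximal_independent_le[OF finV(1)]) (auto simp: E_def)
  also have "\<dots> \<le> 3 powr (real (card (cnf_atoms T)) / 3)"
    using finV by (intro powr_mono) auto
  finally show ?thesis .
qed

section \<open>From programs to CNF theories\<close>

definition clause_of :: "'a pclause \<Rightarrow> 'a literal set" where
  "clause_of C = Pos ` (head C \<union> nbody C) \<union> Neg ` pbody C"

text \<open>The side condition drops tautologies, since \<open>cnf_theory\<close> forbids
  complementary literals.\<close>

definition cnf_of :: "'a pclause set \<Rightarrow> 'a literal set set" where
  "cnf_of P = {clause_of C | C. C \<in> P \<and> (head C \<union> nbody C) \<inter> pbody C = {}}"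

lemma cnf_theory_cnf_of:
  assumes "disjunctive_program t P"
  shows "cnf_theory t (cnf_of P)"
proof -
  have "card (clause_of C) \<le> t" "finite (clause_of C)" if "C \<in> P" for C
  proof -
    have fin: "finite (head C)" "finite (pbody C)" "finite (nbody C)"
      and le: "card (head C) + card (pbody C) + card (nbody C) \<le> t"
      using assms that by (auto simp: disjunctive_program_def)
    have "card (clause_of C) \<le> card (Pos ` (head C \<union> nbody C)) + card (Neg ` pbody C)"
      unfolding clause_of_def by (rule card_Un_le)
    also have "\<dots> \<le> card (head C \<union> nbody C) + card (pbody C)"
      using fin by (intro add_mono card_image_le) auto
    also have "\<dots> \<le> t"
      using card_Un_le[of "head C" "nbody C"] le by linarith
    finally show "card (clause_of C) \<le> t" .
    show "finite (clause_of C)" using fin by (simp add: clause_of_def)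
  qed
  moreover have "finite (cnf_of P)"
    using assms by (auto simp: disjunctive_program_def cnf_of_def)
  ultimately show ?thesis
    unfolding cnf_theory_def by (auto simp: cnf_of_def) (auto simp: clause_of_def)
qed

lemma cnf_atoms_cnf_of: "cnf_atoms (cnf_of P) \<subseteq> program_atoms P"
  by (auto simp: cnf_atoms_def cnf_of_def clause_of_def program_atoms_def)

lemma finite_program_atoms: "disjunctive_program t P \<Longrightarrow> finite (program_atoms P)"
  by (auto simp: disjunctive_program_def program_atoms_def)

lemma cnf_model_cnf_of: "cnf_model (cnf_of P) M \<longleftrightarrow> program_model P M"
proof -
  have sat: "(\<exists>l\<in>clause_of C. sat_literal M l) \<longleftrightarrow>
      (pbody C \<subseteq> M \<and> nbody C \<inter> M = {} \<longrightarrow> head C \<inter> M \<noteq> {})" for C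
    by (auto simp: clause_of_def bex_Un)
  have "\<exists>l\<in>clause_of C. sat_literal M l" if "(head C \<union> nbody C) \<inter> pbody C \<noteq> {}" for C
    unfolding sat using that by blast
  then have "cnf_model (cnf_of P) M \<longleftrightarrow> (\<forall>C\<in>P. \<exists>l\<in>clause_of C. sat_literal M l)"
    unfolding cnf_model_def cnf_of_def by blast
  then show ?thesis by (simp add: sat program_model_def)
qed

lemma program_model_gl_reduct:
  "program_model (gl_reduct P M) N \<longleftrightarrow>
     (\<forall>C\<in>P. nbody C \<inter> M = {} \<and> pbody C \<subseteq> N \<longrightarrow> head C \<inter> N \<noteq> {})"
  by (fastforce simp: program_model_def gl_reduct_def)

text \<open>If \<open>N\<close> is a proper subset of \<open>M\<close>, a rule kept by the reduct
  has its negative body disjoint from \<open>N\<close> too. So a model \<open>N\<close> of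
  \<open>P\<close> would be a model of the reduct, against minimality there.\<close>

lemma answer_set_minimal_model:
  assumes "answer_set P M"
  shows "minimal_model (program_model P) M"
proof -
  have "program_model P M"
    using assms by (auto simp: answer_set_def minimal_model_def program_model_gl_reduct
        program_model_def[of P])
  moreover have "program_model (gl_reduct P M) N" if "N \<subset> M" "program_model P N" for N
    using that unfolding program_model_gl_reduct program_model_def[of P] by blast
  ultimately show ?thesis
    using assms unfolding answer_set_def minimal_model_def by blast
qed

lemma stable_model_answer_set: "stable_model P M \<Longrightarrow> answer_set P M"
  by (auto simp: stable_model_def answer_set_def least_model_def minimal_model_def)

text \<open>The arbitrary subset \<open>S\<close> lets one statement serve both answer sets and
  stable models.\<close>

theorem card_answer_sets_le:
  assumes P: "disjunctive_program 2 P" and S: "S \<subseteq> {M. answer_set P M}"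
  shows "finite S" and "real (card S) \<le> 3 powr (real (card (program_atoms P)) / 3)"
proof -
  let ?T = "cnf_of P"
  let ?Min = "{M. minimal_model (cnf_model ?T) M}"
  have T: "cnf_theory 2 ?T" by (rule cnf_theory_cnf_of[OF P])
  have "cnf_model ?T = program_model P" by (rule ext) (rule cnf_model_cnf_of)
  then have sub: "S \<subseteq> ?Min" using S answer_set_minimal_model by auto
  have fin: "finite ?Min" by (rule finite_minimal_models[OF T])
  show "finite S" using sub fin by (rule finite_subset)
  have "real (card S) \<le> real (card ?Min)" using card_mono[OF fin sub] by simp
  also have "\<dots> \<le> 3 powr (real (card (cnf_atoms ?T)) / 3)"
    by (rule card_minimal_models_le[OF T])
  also have "\<dots> \<le> 3 powr (real (card (program_atoms P)) / 3)"
    using card_mono[OF finite_program_atoms[OF P] cnf_atoms_cnf_of]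
    by (intro powr_mono) auto
  finally show "real (card S) \<le> 3 powr (real (card (program_atoms P)) / 3)" .
qed

theorem theorem2p2:
  shows "(\<forall>T :: 'a literal set set. cnf_theory 2 T \<longrightarrow>
            finite {M. minimal_model (cnf_model T) M} \<and>
            real (card {M. minimal_model (cnf_model T) M})
              \<le> 3 powr (real (card (cnf_atoms T)) / 3)) \<and>
         (\<forall>P :: 'a pclause set. normal_program 2 P \<longrightarrow>
            finite {M. stable_model P M} \<and>
            real (card {M. stable_model P M})
              \<le> 3 powr (real (card (program_atoms P)) / 3)) \<and>
         (\<forall>P :: 'a pclause set. disjunctive_program 2 P \<longrightarrow>
            finite {M. answer_set P M} \<and>
            real (card {M. answer_set P M})
              \<le> 3 powr (real (card (program_atoms P)) / 3)) \<and>
         (\<forall>n :: nat. (3 :: real) powr (real n / 3) = (3 powr (1 / 3)) ^ n) \<and>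
         (1.4422 :: real) \<le> 3 powr (1 / 3) \<and> (3 :: real) powr (1 / 3) < 1.4423"
proof (intro conjI allI impI)
  fix P :: "'a pclause set"
  assume "normal_program 2 P"
  then have P: "disjunctive_program 2 P" by (simp add: normal_program_def)
  have S: "{M. stable_model P M} \<subseteq> {M. answer_set P M}"
    using stable_model_answer_set by blast
  show "finite {M. stable_model P M}"
    and "real (card {M. stable_model P M}) \<le> 3 powr (real (card (program_atoms P)) / 3)"
    by (fact card_answer_sets_le[OF P S])+
next
  \<comment> \<open>Both decimal bounds follow by cubing and comparing with 3.\<close>
  have "(1.4422 :: real) ^ Suc 2 \<le> (3 powr (1 / 3)) ^ Suc 2"
    using three_powr_third_cube by (simp add: eval_nat_numeral)
  then show "(1.4422 :: real) \<le> 3 powr (1 / 3)"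
    by (rule power_le_imp_le_base) simp
  have "(3 powr (1 / 3)) ^ 3 < (1.4423 :: real) ^ 3"
    using three_powr_third_cube by (simp add: eval_nat_numeral)
  then show "(3 :: real) powr (1 / 3) < 1.4423"
    by (rule power_less_imp_less_base) simp
qed (blast intro: finite_minimal_models card_minimal_models_le card_answer_sets_le
    three_powr_third_power)+

end
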